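(* Assume that $|A|\ge 3$ and $|I|\ge 4$. If $F$ is a unanimous positional social choice correspondence, then $F$ is $\Omega^F$-$\mathbf{K}$-manipulable.
   Context: Standing setting: $A$ (alternatives) and $I$ (individuals) are finite sets with $|A|\ge 2$, $|I|\ge 2$. $P_0(X)$ is the set of nonempty subsets of $X$. For a relation $R$ on a set $X$, $x\succeq_R y$ means $(x,y)\in R$, and $x\succ_R y$ means $(x,y)\in R$ and $(y,x)\notin R$. $\mathcal{L}(A)$ is the set of linear orders (complete, transitive, antisymmetric relations) on $A$; for $q\in\mathcal{L}(A)$, $\mathrm{rank}_q(x)=|\{y\in A: y\succeq_q x\}|$ (so rank $1$ is best). For $J\subseteq I$, $\mathcal{L}(A)^J$ is the set of functions $J\to\mathcal{L}(A)$. For $i\in I$, $\overline{p}\in\mathcal{L}(A)^{I\setminus\{i\}}$, $q\in\mathcal{L}(A)$, $(\overline{p},q[i])\in\mathcal{L}(A)^I$ is the profile equal to $q$ at $i$ and to $\overline{p}(j)$ at every $j\ne i$. A social choice correspondence (scc) is a function $F:\mathcal{L}(A)^I\to P_0(A)$. Positional: a scoring vector is $w=(w_1,\ldots,w_{|A|})\in\mathbb{R}^{|A|}$ with $w_1\ge w_2\ge\cdots\ge w_{|A|}$ and $w_1>w_{|A|}$. The scc $F$ is positional if there is a scoring vector $w$ such that, for every $p\in\mathcal{L}(A)^I$, $F(p)=\mathrm{argmax}_{x\in A}\sum_{i\in I}w_{\mathrm{rank}_{p(i)}(x)}$ (set of all maximizers). Unanimous: for every $p\in\mathcal{L}(A)^I$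 and $x\in A$, if $\mathrm{rank}_{p(i)}(x)=1$ for all $i\in I$ then $F(p)=\{x\}$. Kelly extension rule: for $q\in\mathcal{L}(A)$, $\mathbf{K}(q)$ is the relation on $P_0(A)$ given by $(B,C)\in\mathbf{K}(q)$ iff $B=C$ or $x\succeq_q y$ for all $x\in B$, $y\in C$. Winner information: for $i\in I$, $q\in\mathcal{L}(A)$, $\Omega^F_i(q)=\big\{\{\overline{p}\in\mathcal{L}(A)^{I\setminus\{i\}}:F(\overline{p},q[i])=X\}: X\in\mathrm{Im}(F)\big\}\setminus\{\varnothing\}$. $F$ is $\Omega^F$-$\mathbf{K}$-manipulable if there exist $i\in I$, $q,q'\in\mathcal{L}(A)$ and $\omega\in\Omega^F_i(q)$ such that $F(\overline{p}',q'[i])\succ_{\mathbf{K}(q)}F(\overline{p}',q[i])$ for some $\overline{p}'\in\omega$, and $F(\overline{p},q'[i])\succeq_{\mathbf{K}(q)}F(\overline{p},q[i])$ for every $\overline{p}\in\omega$. *)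

theory Defs
  imports Complex_Main "HOL-Library.FuncSet"
begin

text \<open>
  A pair \<open>(x, y)\<close> in a relation \<open>R\<close> means that \<open>x\<close> is at least as good as \<open>y\<close>.
\<close>

definition weakly_prefers :: "'x rel \<Rightarrow> 'x \<Rightarrow> 'x \<Rightarrow> bool" where
  "weakly_prefers R x y \<longleftrightarrow> (x, y) \<in> R"

definition strictly_prefers :: "'x rel \<Rightarrow> 'x \<Rightarrow> 'x \<Rightarrow> bool" where
  "strictly_prefers R x y \<longleftrightarrow> (x, y) \<in> R \<and> (y, x) \<notin> R"

definition nonempty_subsets :: "'x set \<Rightarrow> 'x set set" where
  "nonempty_subsets X = Pow X - {{}}"

definition linear_orders :: "'a set \<Rightarrow> 'a rel set" where
  "linear_orders A = {q. linear_order_on A q}"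

text \<open>Rank 1 is the best position.\<close>

definition rank_of :: "'a set \<Rightarrow> 'a rel \<Rightarrow> 'a \<Rightarrow> nat" where
  "rank_of A q x = card {y \<in> A. weakly_prefers q y x}"

text \<open>
  Profiles are extensional functions (equal to \<open>undefined\<close> outside \<open>J\<close>), so that they
  correspond one-to-one to the functions with domain \<open>J\<close>. If \<open>p\<close> is a profile on
  \<open>I - {i}\<close> with \<open>i \<in> I\<close>, then \<open>p(i := q)\<close> is the profile on \<open>I\<close> obtained by
  adding the preference \<open>q\<close> of individual \<open>i\<close>.
\<close>

definition profiles :: "'a set \<Rightarrow> 'i set \<Rightarrow> ('i \<Rightarrow> 'a rel) set" where
  "profiles A J = (J \<rightarrow>\<^sub>E linear_orders A)"

text \<open>The values of \<open>F\<close> outside \<open>profiles A I\<close> are irrelevant.\<close>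

definition scc :: "'a set \<Rightarrow> 'i set \<Rightarrow> (('i \<Rightarrow> 'a rel) \<Rightarrow> 'a set) \<Rightarrow> bool" where
  "scc A I F \<longleftrightarrow> F \<in> profiles A I \<rightarrow> nonempty_subsets A"

text \<open>Only the entries of \<open>w\<close> at the indices \<open>1, \<dots>, n\<close> matter.\<close>

definition scoring_vector :: "nat \<Rightarrow> (nat \<Rightarrow> real) \<Rightarrow> bool" where
  "scoring_vector n w \<longleftrightarrow> antimono_on {1..n} w \<and> w 1 > w n"

definition score :: "'a set \<Rightarrow> 'i set \<Rightarrow> (nat \<Rightarrow> real) \<Rightarrow> ('i \<Rightarrow> 'a rel) \<Rightarrow> 'a \<Rightarrow> real" where
  "score A I w p x = (\<Sum>i\<in>I. w (rank_of A (p i) x))"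

definition positional :: "'a set \<Rightarrow> 'i set \<Rightarrow> (('i \<Rightarrow> 'a rel) \<Rightarrow> 'a set) \<Rightarrow> bool" where
  "positional A I F \<longleftrightarrow>
    (\<exists>w. scoring_vector (card A) w \<and>
      (\<forall>p \<in> profiles A I. F p = {x. is_arg_max (score A I w p) (\<lambda>y. y \<in> A) x}))"

definition unanimous :: "'a set \<Rightarrow> 'i set \<Rightarrow> (('i \<Rightarrow> 'a rel) \<Rightarrow> 'a set) \<Rightarrow> bool" where
  "unanimous A I F \<longleftrightarrow>
    (\<forall>p \<in> profiles A I. \<forall>x \<in> A. (\<forall>i \<in> I. rank_of A (p i) x = 1) \<longrightarrow> F p = {x})"

definition kelly :: "'a set \<Rightarrow> 'a rel \<Rightarrow> 'a set rel" where
  "kelly A q = {(B, C). B \<in> nonempty_subsets A \<and> C \<in> nonempty_subsets A \<and>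
    (B = C \<or> (\<forall>x \<in> B. \<forall>y \<in> C. weakly_prefers q x y))}"

definition winner_info ::
    "'a set \<Rightarrow> 'i set \<Rightarrow> (('i \<Rightarrow> 'a rel) \<Rightarrow> 'a set) \<Rightarrow> 'i \<Rightarrow> 'a rel \<Rightarrow> ('i \<Rightarrow> 'a rel) set set" where
  "winner_info A I F i q =
    {{p \<in> profiles A (I - {i}). F (p(i := q)) = X} | X. X \<in> F ` profiles A I} - {{}}"

text \<open>
  The parameter \<open>\<Omega>\<close> is the information function (the pieces of information that an
  individual with a given preference may have about the others), and \<open>E\<close> is the
  extension rule from preferences on alternatives to preferences on sets of alternatives.
\<close>

definition manipulable ::
    "'a set \<Rightarrow> 'i set \<Rightarrow> ('i \<Rightarrow> 'a rel \<Rightarrow> ('i \<Rightarrow> 'a rel) set set) \<Rightarrow> ('a rel \<Rightarrow> 'a set rel)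
      \<Rightarrow> (('i \<Rightarrow> 'a rel) \<Rightarrow> 'a set) \<Rightarrow> bool" where
  "manipulable A I \<Omega> E F \<longleftrightarrow>
    (\<exists>i \<in> I. \<exists>q \<in> linear_orders A. \<exists>q' \<in> linear_orders A. \<exists>\<omega> \<in> \<Omega> i q.
      (\<exists>p \<in> \<omega>. strictly_prefers (E q) (F (p(i := q'))) (F (p(i := q)))) \<and>
      (\<forall>p \<in> \<omega>. weakly_prefers (E q) (F (p(i := q'))) (F (p(i := q)))))"

end

theory Submission
  imports Defs
begin

text \<open>
  Unanimity forces \<open>w 1 > w 2\<close>. Let individual \<open>i\<close> rank \<open>x > z > y > \<dots>\<close> and consider lying by
  exchanging the top two alternatives: this raises the score of \<open>z\<close> by \<open>w 1 - w 2\<close>, lowers that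
  of \<open>x\<close>, and changes no other score. Hence if the announced winner set is \<open>{y}\<close> it becomes a
  nonempty subset of \<open>{y, z}\<close>, and if it is \<open>{y, z}\<close> it becomes \<open>{z}\<close>; so the lie never hurts.
  To obtain a profile where it helps, let one other individual rank \<open>y > x > z\<close> and split the
  remaining \<open>n - 2\<close> as evenly as possible between \<open>y > z > x\<close> (\<open>a\<close> of them) and \<open>z > y > x\<close>
  (\<open>b\<close> of them), with a common ranking of the other alternatives below. Then the score of \<open>y\<close>
  exceeds that of \<open>z\<close> by \<open>(1 + a - b) (w 1 - w 2)\<close>: the winner set is \<open>{y}\<close> and the lie
  produces a tie if \<open>a = b\<close>, and the winner set is \<open>{y, z}\<close> if \<open>b = a + 1\<close>.
\<close>

section \<open>Linear orders written as lists, best alternative first\<close>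

definition list_order :: "'a list \<Rightarrow> 'a rel" where
  "list_order l = {(l ! i, l ! j) | i j. i \<le> j \<and> j < length l}"

lemma list_order_nth_iff:
  assumes "distinct l" "i < length l" "j < length l"
  shows "(l ! i, l ! j) \<in> list_order l \<longleftrightarrow> i \<le> j"
proof
  assume "(l ! i, l ! j) \<in> list_order l"
  then obtain i' j' where "l ! i = l ! i'" "l ! j = l ! j'" "i' \<le> j'" "j' < length l"
    by (auto simp: list_order_def)
  with assms show "i \<le> j"
    by (metis nth_eq_iff_index_eq order.strict_trans1)
qed (use assms in \<open>auto simp: list_order_def\<close>)

lemma list_order_in_linear_orders:
  assumes "distinct l"
  shows "list_order l \<in> linear_orders (set l)"
proof -
  have mem: "(u, v) \<in> list_order l \<longleftrightarrow>
      (\<exists>i j. i \<le> j \<and> j < length l \<and> u = l ! i \<and> v = l ! j)" for u v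
    by (auto simp: list_order_def)
  have "refl_on (set l) (list_order l)"
    unfolding refl_on_def mem by (metis in_set_conv_nth order_refl)
  moreover have "list_order l \<subseteq> set l \<times> set l"
    by (auto simp: list_order_def)
  moreover have "trans (list_order l)"
  proof (rule transI)
    fix u v t assume "(u, v) \<in> list_order l" "(v, t) \<in> list_order l"
    then obtain i j i' j' where "i \<le> j" "j < length l" "u = l ! i" "v = l ! j"
      "i' \<le> j'" "j' < length l" "v = l ! i'" "t = l ! j'"
      unfolding mem by blast
    moreover from this have "j = i'"
      using assms by (metis nth_eq_iff_index_eq order.strict_trans1)
    ultimately show "(u, t) \<in> list_order l"
      unfolding mem by (metis order_trans)
  qed
  moreover have "antisym (list_order l)"
  proof (rule antisymI)
    fix u v assume uv: "(u, v) \<in> list_order l" "(v, u) \<in> list_order l"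
    then obtain i j where "i < length l" "j < length l" "u = l ! i" "v = l ! j"
      unfolding mem by (meson order.strict_trans1)
    with uv assms show "u = v"
      by (auto simp: list_order_nth_iff)
  qed
  moreover have "total_on (set l) (list_order l)"
  proof (rule total_onI)
    fix u v assume "u \<in> set l" "v \<in> set l"
    then obtain i j where "i < length l" "j < length l" "u = l ! i" "v = l ! j"
      by (metis in_set_conv_nth)
    with assms show "(u, v) \<in> list_order l \<or> (v, u) \<in> list_order l"
      by (auto simp: list_order_nth_iff)
  qed
  ultimately show ?thesis
    by (simp add: linear_orders_def linear_order_on_def partial_order_on_def preorder_on_def)
qed

lemma rank_of_list_order:
  assumes "distinct l" "k < length l"
  shows "rank_of (set l) (list_order l) (l ! k) = Suc k"
proof -
  have "{u \<in> set l. weakly_prefers (list_order l) u (l ! k)} = (!) l ` {..k}"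
    using assms
    by (auto simp: weakly_prefers_def in_set_conv_nth list_order_nth_iff intro: le_less_trans)
  moreover have "inj_on ((!) l) {..k}"
    using assms by (auto simp: inj_on_def nth_eq_iff_index_eq)
  ultimately show ?thesis
    by (simp add: rank_of_def card_image)
qed

lemma rank_of_list_order_Cons3:
  assumes "distinct (a # b # c # r)" and "A = set (a # b # c # r)"
  shows "rank_of A (list_order (a # b # c # r)) a = 1"
    and "rank_of A (list_order (a # b # c # r)) b = 2"
    and "rank_of A (list_order (a # b # c # r)) c = 3"
    and "k < length r \<Longrightarrow> rank_of A (list_order (a # b # c # r)) (r ! k) = k + 4"
  using rank_of_list_order[OF assms(1), of 0] rank_of_list_order[OF assms(1), of 1]
    rank_of_list_order[OF assms(1), of 2] rank_of_list_order[OF assms(1), of "k + 3"] assms(2)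
  by (simp_all add: numeral_2_eq_2 numeral_3_eq_3)

text \<open>The tail \<open>r\<close> fixes a common ranking of the alternatives other than \<open>x\<close>, \<open>y\<close>, \<open>z\<close>.\<close>

locale unanimous_positional =
  fixes A :: "'a set" and I :: "'i set" and F :: "('i \<Rightarrow> 'a rel) \<Rightarrow> 'a set"
    and w :: "nat \<Rightarrow> real" and x y z :: 'a and r :: "'a list"
  assumes dist: "distinct (x # y # z # r)" and A: "A = set (x # y # z # r)"
    and finI: "finite I" and cardI: "card I \<ge> 4"
    and una: "unanimous A I F"
    and scoring: "scoring_vector (card A) w"
    and F_eq: "\<And>p. p \<in> profiles A I \<Longrightarrow>
      F p = {x. is_arg_max (score A I w p) (\<lambda>y. y \<in> A) x}"
begin

section \<open>Winner sets as score maximizers, and the ranks in the orders used\<close>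

lemma mem_F_iff:
  assumes "p \<in> profiles A I"
  shows "v \<in> F p \<longleftrightarrow> v \<in> A \<and> (\<forall>u\<in>A. score A I w p u \<le> score A I w p v)"
  using F_eq[OF assms] by (auto simp: is_arg_max_def not_less)

lemma F_nonempty:
  assumes "p \<in> profiles A I"
  shows "F p \<noteq> {}"
proof -
  let ?S = "score A I w p ` A"
  have "finite ?S" "?S \<noteq> {}" using A by auto
  then have "Max ?S \<in> ?S" "\<forall>u\<in>A. score A I w p u \<le> Max ?S" by auto
  then obtain v where "v \<in> A" "\<forall>u\<in>A. score A I w p u \<le> score A I w p v"
    by (metis (no_types, lifting) imageE)
  then show ?thesis using mem_F_iff[OF assms] by blast
qed

text \<open>One hypothesis covers every permutation of the three top alternatives: since
  \<open>{x, y, z}\<close> has three elements, the equation of sets already forces \<open>a\<close>,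
  \<open>b\<close>, \<open>c\<close> to be distinct.\<close>

lemma perm_orders:
  assumes "{a, b, c} = {x, y, z}"
  shows "list_order (a # b # c # r) \<in> linear_orders A"
    and "rank_of A (list_order (a # b # c # r)) a = 1"
    and "rank_of A (list_order (a # b # c # r)) b = 2"
    and "rank_of A (list_order (a # b # c # r)) c = 3"
    and "k < length r \<Longrightarrow> rank_of A (list_order (a # b # c # r)) (r ! k) = k + 4"
proof -
  have "card {a, b, c} = 3" using assms dist by simp
  then have "a \<noteq> b" "a \<noteq> c" "b \<noteq> c"
    by (auto simp: card_insert_if split: if_splits)
  moreover have "a \<in> {x, y, z}" "b \<in> {x, y, z}" "c \<in> {x, y, z}"
    using assms by blast+
  ultimately have d: "distinct (a # b # c # r)" using dist by auto
  have s: "A = set (a # b # c # r)" using A assms by auto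
  show "list_order (a # b # c # r) \<in> linear_orders A"
    using list_order_in_linear_orders[OF d] s by simp
  show "rank_of A (list_order (a # b # c # r)) a = 1"
    and "rank_of A (list_order (a # b # c # r)) b = 2"
    and "rank_of A (list_order (a # b # c # r)) c = 3"
    and "k < length r \<Longrightarrow> rank_of A (list_order (a # b # c # r)) (r ! k) = k + 4"
    using rank_of_list_order_Cons3[OF d s] by auto
qed

abbreviation xzy where "xzy \<equiv> list_order (x # z # y # r)"
abbreviation zxy where "zxy \<equiv> list_order (z # x # y # r)"
abbreviation yxz where "yxz \<equiv> list_order (y # x # z # r)"
abbreviation yzx where "yzx \<equiv> list_order (y # z # x # r)"
abbreviation zyx where "zyx \<equiv> list_order (z # y # x # r)"

lemma
  shows xzy: "xzy \<in> linear_orders A" "rank_of A xzy x = 1" "rank_of A xzy y = 3"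
      "rank_of A xzy z = 2" "k < length r \<Longrightarrow> rank_of A xzy (r ! k) = k + 4"
    and zxy: "zxy \<in> linear_orders A" "rank_of A zxy x = 2" "rank_of A zxy y = 3"
      "rank_of A zxy z = 1" "k < length r \<Longrightarrow> rank_of A zxy (r ! k) = k + 4"
    and yxz: "yxz \<in> linear_orders A" "rank_of A yxz x = 2" "rank_of A yxz y = 1"
      "rank_of A yxz z = 3" "k < length r \<Longrightarrow> rank_of A yxz (r ! k) = k + 4"
    and yzx: "yzx \<in> linear_orders A" "rank_of A yzx x = 3" "rank_of A yzx y = 1"
      "rank_of A yzx z = 2" "k < length r \<Longrightarrow> rank_of A yzx (r ! k) = k + 4"
    and zyx: "zyx \<in> linear_orders A" "rank_of A zyx x = 3" "rank_of A zyx y = 2"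
      "rank_of A zyx z = 1" "k < length r \<Longrightarrow> rank_of A zyx (r ! k) = k + 4"
  using perm_orders[of x z y] perm_orders[of z x y] perm_orders[of y x z]
    perm_orders[of y z x] perm_orders[of z y x]
  by (simp_all add: insert_commute)

lemmas ranks = xzy zxy yxz yzx zyx

lemma A_cases:
  assumes "v \<in> A"
  obtains "v = x" | "v = y" | "v = z" | k where "k < length r" "v = r ! k"
  using assms unfolding A by (auto simp: in_set_conv_nth)

lemma card_A: "card A = length r + 3"
  using distinct_card[OF dist] A by simp

lemma w_antimono: "1 \<le> j \<Longrightarrow> j \<le> k \<Longrightarrow> k \<le> length r + 3 \<Longrightarrow> w k \<le> w j"
  using scoring card_A by (auto simp: scoring_vector_def monotone_on_def)

text \<open>If \<open>w 1\<close> and \<open>w 2\<close> were equal, then in the profile where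
  everyone reports \<open>xzy\<close> the second-ranked \<open>z\<close> would tie with
  \<open>x\<close>, while unanimity makes \<open>x\<close> the only winner.\<close>

lemma w_strict: "w 2 < w 1"
proof (rule ccontr)
  assume "\<not> w 2 < w 1"
  then have le: "w 1 \<le> w 2" by simp
  define p where "p = (\<lambda>j\<in>I. xzy)"
  have p: "p \<in> profiles A I" using xzy(1) by (auto simp: p_def profiles_def)
  have score: "score A I w p v = real (card I) * w (rank_of A xzy v)" for v
    by (simp add: score_def p_def)
  have "w (rank_of A xzy v) \<le> w 1" if "v \<in> A" for v
    using that by (rule A_cases) (auto simp: xzy intro!: w_antimono)
  then have "score A I w p v \<le> score A I w p z" if "v \<in> A" for v
    using that le unfolding score xzy by (intro mult_left_mono) force+
  then have "z \<in> F p" using mem_F_iff[OF p] A by simp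
  moreover have "F p = {x}"
    using una p A xzy by (auto simp: unanimous_def p_def)
  ultimately show False using dist by simp
qed

section \<open>Effect of exchanging the top two alternatives\<close>

lemma profiles_upd:
  assumes "i \<in> I" "p \<in> profiles A (I - {i})" "q \<in> linear_orders A"
  shows "p(i := q) \<in> profiles A I"
proof -
  have "p(i := q) \<in> insert i (I - {i}) \<rightarrow>\<^sub>E linear_orders A"
    using assms(2,3) unfolding profiles_def by (rule PiE_fun_upd[rotated])
  with assms(1) show ?thesis by (simp add: profiles_def insert_absorb)
qed

lemma score_upd:
  assumes "i \<in> I"
  shows "score A I w (p(i := q)) v = w (rank_of A q v) + (\<Sum>j\<in>I - {i}. w (rank_of A (p j) v))"
  using finI assms by (simp add: score_def sum.remove)

text \<open>The second part is an inequality so that it covers \<open>x\<close>, which falls from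
  rank 1 to rank 2, together with the alternatives whose rank does not change.\<close>

lemma score_exchange:
  assumes "i \<in> I"
  shows "score A I w (p(i := zxy)) z = score A I w (p(i := xzy)) z + (w 1 - w 2)"
    and "v \<in> A \<Longrightarrow> v \<noteq> z \<Longrightarrow> score A I w (p(i := zxy)) v \<le> score A I w (p(i := xzy)) v"
    and "score A I w (p(i := zxy)) y = score A I w (p(i := xzy)) y"
  using w_strict by (auto simp: score_upd[OF assms] ranks elim!: A_cases)

text \<open>A new winner outside \<open>{y, z}\<close> would score at least as much as
  \<open>y\<close>, whose score is unchanged. Its own score did not rise, so it would have won
  alongside \<open>y\<close> before the lie.\<close>

lemma F_exchange_single:
  assumes "i \<in> I" "p \<in> profiles A (I - {i})" "F (p(i := xzy)) = {y}"
  shows "F (p(i := zxy)) \<subseteq> {y, z}"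
proof
  fix v assume v: "v \<in> F (p(i := zxy))"
  have P: "p(i := xzy) \<in> profiles A I" "p(i := zxy) \<in> profiles A I"
    using profiles_upd assms xzy(1) zxy(1) by auto
  show "v \<in> {y, z}"
  proof (rule ccontr)
    assume nv: "v \<notin> {y, z}"
    have vA: "v \<in> A" and "score A I w (p(i := zxy)) y \<le> score A I w (p(i := zxy)) v"
      using v mem_F_iff[OF P(2)] A by auto
    then have "score A I w (p(i := xzy)) y \<le> score A I w (p(i := xzy)) v"
      using score_exchange(2)[OF assms(1), of v p] score_exchange(3)[OF assms(1), of p] nv
      by simp
    moreover have "y \<in> F (p(i := xzy))" using assms(3) by simp
    ultimately have "v \<in> F (p(i := xzy))"
      using mem_F_iff[OF P(1)] vA by fastforce
    then show False using assms(3) nv by simp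
  qed
qed

text \<open>Before the lie \<open>z\<close> is already a maximizer, and its score is the only one
  that rises, so afterwards it is strictly ahead of all others.\<close>

lemma F_exchange_pair:
  assumes "i \<in> I" "p \<in> profiles A (I - {i})" "F (p(i := xzy)) = {y, z}"
  shows "F (p(i := zxy)) = {z}"
proof -
  have P: "p(i := xzy) \<in> profiles A I" "p(i := zxy) \<in> profiles A I"
    using profiles_upd assms xzy(1) zxy(1) by auto
  have zA: "z \<in> A" using A by simp
  have "z \<in> F (p(i := xzy))" using assms(3) by simp
  then have max: "score A I w (p(i := xzy)) v \<le> score A I w (p(i := xzy)) z" if "v \<in> A" for v
    using that mem_F_iff[OF P(1)] by blast
  have lt: "score A I w (p(i := zxy)) v < score A I w (p(i := zxy)) z" if "v \<in> A" "v \<noteq> z" for v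
    using max[OF that(1)] score_exchange(1)[OF assms(1), of p]
      score_exchange(2)[OF assms(1) that, of p] w_strict by linarith
  have "v = z" if "v \<in> F (p(i := zxy))" for v
  proof (rule ccontr)
    assume "v \<noteq> z"
    moreover have "v \<in> A" "score A I w (p(i := zxy)) z \<le> score A I w (p(i := zxy)) v"
      using that mem_F_iff[OF P(2)] zA by auto
    ultimately show False using lt[of v] by simp
  qed
  with F_nonempty[OF P(2)] show ?thesis by blast
qed

section \<open>From one pivotal profile to manipulability\<close>

lemma xzy_pref: "(z, y) \<in> xzy" "(y, z) \<notin> xzy" "(y, y) \<in> xzy" "(z, z) \<in> xzy"
proof -
  have d: "distinct (x # z # y # r)" using dist by auto
  show "(z, y) \<in> xzy" "(y, z) \<notin> xzy" "(y, y) \<in> xzy" "(z, z) \<in> xzy"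
    using list_order_nth_iff[OF d, of 1 2] list_order_nth_iff[OF d, of 2 1]
      list_order_nth_iff[OF d, of 2 2] list_order_nth_iff[OF d, of 1 1] by simp_all
qed

text \<open>The information held is the winner set under truth-telling at \<open>p\<close>. The
  exchange lemmas show that the lie is safe at every profile compatible with it; the given
  \<open>p\<close> supplies the strict gain.\<close>

lemma manipulable_if_pivotal:
  assumes i: "i \<in> I" and p: "p \<in> profiles A (I - {i})"
    and FX: "F (p(i := xzy)) = {y} \<and> z \<in> F (p(i := zxy)) \<or> F (p(i := xzy)) = {y, z}"
  shows "manipulable A I (winner_info A I F) (kelly A) F"
proof -
  define X where "X = F (p(i := xzy))"
  define \<omega> where "\<omega> = {p \<in> profiles A (I - {i}). F (p(i := xzy)) = X}"
  have p\<omega>: "p \<in> \<omega>" using p by (simp add: \<omega>_def X_def)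
  have "X \<in> F ` profiles A I"
    using profiles_upd[OF i p xzy(1)] by (simp add: X_def)
  \<comment> \<open>\<open>winner_info\<close> discards the empty set, so the witness
    \<open>p\<close> is used here as well.\<close>
  then have \<omega>: "\<omega> \<in> winner_info A I F i xzy"
    using p\<omega> unfolding winner_info_def \<omega>_def by blast
  have X: "X = {y} \<or> X = {y, z}" using FX X_def by blast
  have yz: "y \<in> A" "z \<in> A" "y \<noteq> z" using A dist by auto
  have weak: "weakly_prefers (kelly A xzy) (F (p'(i := zxy))) (F (p'(i := xzy)))"
    if "p' \<in> \<omega>" for p'
  proof -
    from that have p': "p' \<in> profiles A (I - {i})" "F (p'(i := xzy)) = X"
      by (auto simp: \<omega>_def)
    have ne: "F (p'(i := zxy)) \<noteq> {}"
      using F_nonempty profiles_upd[OF i p'(1) zxy(1)] by blast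
    from X show ?thesis
    proof
      assume "X = {y}"
      then show ?thesis
        using F_exchange_single[OF i p'(1)] p'(2) ne yz xzy_pref
        by (auto simp: weakly_prefers_def kelly_def nonempty_subsets_def)
    next
      assume "X = {y, z}"
      then show ?thesis
        using F_exchange_pair[OF i p'(1)] p'(2) yz xzy_pref
        by (auto simp: weakly_prefers_def kelly_def nonempty_subsets_def)
    qed
  qed
  have "z \<in> F (p(i := zxy))" "F (p(i := zxy)) \<noteq> X"
    using FX F_exchange_pair[OF i p] yz X_def by auto
  \<comment> \<open>The two sets differ, and the reverse comparison would require \<open>y\<close>
    in \<open>X\<close> to be at least as good as \<open>z\<close>, which \<open>xzy\<close>
    denies.\<close>
  then have "(X, F (p(i := zxy))) \<notin> kelly A xzy"
    using X xzy_pref(2) by (auto simp: kelly_def weakly_prefers_def)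
  then have "strictly_prefers (kelly A xzy) (F (p(i := zxy))) (F (p(i := xzy)))"
    using weak[OF p\<omega>] by (simp add: strictly_prefers_def weakly_prefers_def X_def)
  with weak i xzy(1) zxy(1) \<omega> p\<omega> show ?thesis
    unfolding manipulable_def by blast
qed

section \<open>Construction of a pivotal profile\<close>

lemma manipulable: "manipulable A I (winner_info A I F) (kelly A) F"
proof -
  define a where "a = (card I - 2) div 2"
  define b where "b = card I - 2 - a"
  have "n = 2 * (n div 2) \<or> n = 2 * (n div 2) + 1" for n :: nat
    by linarith
  then have "card I - 2 = 2 * a \<or> card I - 2 = 2 * a + 1"
    unfolding a_def .
  then have a: "a \<ge> 1" and b: "b = a \<or> b = a + 1" and cI: "card I = 2 + a + b"
    using cardI unfolding b_def by linarith+
  have "I \<noteq> {}" using cardI by auto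
  then obtain i where i: "i \<in> I" by blast
  \<comment> \<open>Individual \<open>j\<close> will report \<open>yxz\<close>, those in
    \<open>P\<close> will report \<open>yzx\<close>, and those in \<open>J - P\<close> will report
    \<open>zyx\<close>.\<close>
  have "card (I - {i}) = Suc (a + b)" using i cI by simp
  then obtain j J where J: "I - {i} = insert j J" "j \<notin> J" "card J = a + b"
    by (metis card_Suc_eq)
  have finJ: "finite J" using J(1) finI by (metis finite_Diff finite_insert)
  obtain P where P: "P \<subseteq> J" "card P = a"
    using obtain_subset_with_card_n[of a J] J(3) by auto
  have cQ: "card (J - P) = b"
    using P J(3) finJ by (simp add: card_Diff_subset finite_subset)
  define p where "p = (\<lambda>k\<in>I - {i}. if k = j then yxz else if k \<in> P then yzx else zyx)"
  have p: "p \<in> profiles A (I - {i})"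
    using ranks by (auto simp: p_def profiles_def)
  have score_p: "score A I w (p(i := q)) v = w (rank_of A q v) + w (rank_of A yxz v)
      + a * w (rank_of A yzx v) + b * w (rank_of A zyx v)" for q v
  proof -
    have "(\<Sum>k\<in>J. w (rank_of A (p k) v)) =
        (\<Sum>k\<in>J - P. w (rank_of A (p k) v)) + (\<Sum>k\<in>P. w (rank_of A (p k) v))"
      using P(1) finJ by (intro sum.subset_diff)
    also have "(\<Sum>k\<in>J - P. w (rank_of A (p k) v)) = (\<Sum>k\<in>J - P. w (rank_of A zyx v))"
      using J by (intro sum.cong) (auto simp: p_def)
    also have "(\<Sum>k\<in>P. w (rank_of A (p k) v)) = (\<Sum>k\<in>P. w (rank_of A yzx v))"
      using J P by (intro sum.cong) (auto simp: p_def)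
    finally have "(\<Sum>k\<in>J. w (rank_of A (p k) v))
        = b * w (rank_of A zyx v) + a * w (rank_of A yzx v)"
      using cQ P(2) by simp
    moreover have "p j = yxz" using J by (simp add: p_def)
    ultimately show ?thesis
      using J finJ by (simp add: score_upd[OF i])
  qed
  let ?s = "score A I w (p(i := xzy))" and ?s' = "score A I w (p(i := zxy))"
  have P: "p(i := xzy) \<in> profiles A I" "p(i := zxy) \<in> profiles A I"
    using profiles_upd[OF i p] ranks by auto
  have mem: "x \<in> A" "y \<in> A" "z \<in> A" "y \<noteq> z" using A dist by auto
  have w23: "w 3 \<le> w 2" by (rule w_antimono) auto
  have sy: "?s y = (1 + real a) * w 1 + b * w 2 + w 3"
    by (simp add: score_p ranks algebra_simps)
  have sz: "?s z = b * w 1 + (1 + real a) * w 2 + w 3"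
    by (simp add: score_p ranks algebra_simps)
  \<comment> \<open>The factor \<open>1 + real a - b\<close> is 1 if \<open>b = a\<close> and 0 if
    \<open>b = a + 1\<close>.\<close>
  have yz: "?s y - ?s z = (1 + real a - b) * (w 1 - w 2)"
    unfolding sy sz by (simp add: algebra_simps)
  \<comment> \<open>The right-hand side is \<open>?s y - ?s x\<close>. It is positive because four
    individuals guarantee \<open>a \<ge> 1\<close>, hence also \<open>b \<ge> 1\<close>.\<close>
  have "0 < a * (w 1 - w 3) + (real b - 1) * (w 2 - w 3)"
    using a b w23 w_strict by (intro add_pos_nonneg mult_pos_pos mult_nonneg_nonneg) auto
  then have sx: "?s x < ?s y"
    unfolding sy by (simp add: score_p ranks algebra_simps)
  have sr: "?s (r ! k) < ?s y" if k: "k < length r" for k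
  proof -
    have "w (k + 4) \<le> w 3" using k by (intro w_antimono) auto
    \<comment> \<open>The right-hand side is \<open>?s y - ?s (r ! k)\<close>, as all individuals
      place \<open>r ! k\<close> at rank \<open>k + 4\<close>.\<close>
    then have "0 < (1 + real a) * (w 1 - w (k + 4)) + b * (w 2 - w (k + 4)) + (w 3 - w (k + 4))"
      using w23 w_strict by (intro add_pos_nonneg mult_pos_pos mult_nonneg_nonneg) auto
    then show ?thesis
      unfolding sy using k by (simp add: score_p ranks algebra_simps)
  qed
  have lt: "?s v < ?s y" if "v \<in> A" "v \<noteq> y" "v \<noteq> z" for v
    using that(1) by (rule A_cases) (use that sx sr in auto)
  show ?thesis
  proof (rule manipulable_if_pivotal[OF i p])
    from b show "F (p(i := xzy)) = {y} \<and> z \<in> F (p(i := zxy)) \<or> F (p(i := xzy)) = {y, z}"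
    proof
      assume "b = a"
      \<comment> \<open>The lead of \<open>y\<close> over \<open>z\<close> is exactly what
        \<open>z\<close> gains by the lie, so \<open>z\<close> reaches the former maximum
        \<open>?s y\<close>.\<close>
      with yz have d: "?s y = ?s z + (w 1 - w 2)" by simp
      have max: "?s v < ?s y" if "v \<in> A" "v \<noteq> y" for v
        using lt[OF that] d w_strict by (cases "v = z") auto
      have "v \<in> F (p(i := xzy)) \<longleftrightarrow> v = y" for v
      proof
        assume "v \<in> F (p(i := xzy))"
        then have "v \<in> A" "?s y \<le> ?s v" using mem_F_iff[OF P(1)] mem by auto
        then show "v = y" using max by force
      next
        have "?s u \<le> ?s y" if "u \<in> A" for u
          using max[OF that] by (cases "u = y") auto
        then show "v = y \<Longrightarrow> v \<in> F (p(i := xzy))"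
          using mem_F_iff[OF P(1)] mem by auto
      qed
      then have "F (p(i := xzy)) = {y}" by blast
      moreover have "?s' v \<le> ?s' z" if "v \<in> A" for v
      proof -
        have "?s' v \<le> ?s v" if "v \<noteq> z"
          using score_exchange(2)[OF i \<open>v \<in> A\<close> that] .
        moreover have "?s v \<le> ?s y"
          using max[OF that] by (cases "v = y") auto
        ultimately show ?thesis
          using score_exchange(1)[OF i, of p] d by (cases "v = z") auto
      qed
      then have "z \<in> F (p(i := zxy))"
        using mem mem_F_iff[OF P(2)] by blast
      ultimately show ?thesis by blast
    next
      assume "b = a + 1"
      with yz have d: "?s y = ?s z" by simp
      have "v \<in> F (p(i := xzy)) \<longleftrightarrow> v \<in> {y, z}" for v
      proof
        assume "v \<in> F (p(i := xzy))"
        then have "v \<in> A" "?s y \<le> ?s v" using mem_F_iff[OF P(1)] mem by auto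
        then show "v \<in> {y, z}" using lt by force
      next
        assume "v \<in> {y, z}"
        moreover have "?s u \<le> ?s y" if "u \<in> A" for u
          using lt[OF that] d by (cases "u = y"; cases "u = z") auto
        ultimately show "v \<in> F (p(i := xzy))"
          using mem_F_iff[OF P(1)] mem d by auto
      qed
      then show ?thesis by blast
    qed
  qed
qed

end

theorem theorem15:
  fixes A :: "'a set" and I :: "'i set"
    and F :: "('i \<Rightarrow> 'a rel) \<Rightarrow> 'a set"
  assumes "finite A" and "finite I"
    and "card A \<ge> 3" and "card I \<ge> 4"
    and "scc A I F"
    and "unanimous A I F"
    and "positional A I F"
  shows "manipulable A I (winner_info A I F) (kelly A) F"
proof -
  \<comment> \<open>Any enumeration of \<open>A\<close> will do: its first three entries become
    \<open>x\<close>, \<open>y\<close>, \<open>z\<close> and the remainder becomes the common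
    tail.\<close>
  obtain l where l: "set l = A" "distinct l"
    using finite_distinct_list[OF assms(1)] by blast
  then have "length l \<ge> 3" using assms(3) distinct_card by metis
  then obtain x y z r where xyz: "l = x # y # z # r"
    by (metis Suc_le_length_iff numeral_3_eq_3)
  obtain w where "scoring_vector (card A) w"
    "\<forall>p \<in> profiles A I. F p = {x. is_arg_max (score A I w p) (\<lambda>y. y \<in> A) x}"
    using assms(7) unfolding positional_def by blast
  then interpret unanimous_positional A I F w x y z r
    using l xyz assms by unfold_locales auto
  show ?thesis by (rule manipulable)
qed

end
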